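(* Let $I\subset\mathbb{R}$ be a nonempty open interval and assume the following. (i) $(T,\mathscr{A},\mu)$ is a measure space. (ii) $\Lambda:T\times\Delta^\circ(I)\to\mathbb{R}_+$ is $\mu$-integrable in its first variable. (iii) $M:T\times\Delta^\circ(I)\to\mathbb{R}$ is $\mathscr{A}$-measurable in its first variable and, for all $t\in T$, the map $(x,y)\mapsto M(t,x,y)$ is a two-variable mean on $I$; $M_0:\Delta^\circ(I)\to I$ is a strict mean such that $$\mu\{t\in T\mid \Lambda(t,x,y)>0,\ M(t,x,y)\neq M_0(x,y)\}>0\qquad\text{for all }(x,y)\in\Delta^\circ(I).$$ (iv) $(\omega_0,\omega_1)$ is a Chebyshev system on $I$ such that $\omega_0$ is positive and, for $i\in\{0,1\}$, $$\omega_i(M_0(x,y))=\int_T\Lambda(t,x,y)\,\omega_i(M(t,x,y))\,d\mu(t)\qquad((x,y)\in\Delta^\circ(I)).$$ For each $(x,y)\in\Delta^\circ(I)$ let $\varepsilon_{x,y}:[x,y]\to\mathbb{R}$ be a function, and let $f:I\to\mathbb{R}$ be a locally upper bounded Borel measurable function satisfying, for all $(x,y)\in\Delta^\circ(I)$, $$f(u)\le\frac{\Omega(u,y)}{\Omega(x,y)}f(x)+\frac{\Omega(x,u)}{\Omega(x,y)}f(y)+\varepsilon_{x,y}(u)\qquad(u\in[x,y]).$$ Suppose that, for all $(x,y)\in\Delta^\circ(I)$ and $u\in\,]x,y[$, the function $(v,w)\mapsto\varepsilon_{v,w}(u)$ is bounded and Borel measurable for $(v,w)\in[x,u]\times[u,y]$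 with $v<w$. Then $f$ also satisfies $$f(M_0(x,y))\le\int_T\Lambda(t,x,y)f(M(t,x,y))\,d\mu(t)+E(x,y)\qquad((x,y)\in\Delta^\circ(I)),$$ where $E:\Delta^\circ(I)\to\mathbb{R}$ is defined by $$E(x,y)=\frac{\int_{T'_{x,y}}\int_{T''_{x,y}}\Lambda(t',x,y)\Lambda(t'',x,y)\,\Omega(M(t',x,y),M(t'',x,y))\,\varepsilon_{M(t',x,y),M(t'',x,y)}(M_0(x,y))\,d\mu(t'')\,d\mu(t')}{\int_{T'_{x,y}}\int_{T''_{x,y}}\Lambda(t',x,y)\Lambda(t'',x,y)\,\Omega(M(t',x,y),M(t'',x,y))\,d\mu(t'')\,d\mu(t')}.$$
   Context: $\mathbb{R}_+$ is the set of nonnegative reals. $\Delta^\circ(I)=\{(x,y)\in I\times I\mid x<y\}$. A pair $(\omega_0,\omega_1)$ of continuous functions $I\to\mathbb{R}$ is a Chebyshev system over $I$ if $\Omega(x,y):=\omega_0(x)\omega_1(y)-\omega_0(y)\omega_1(x)>0$ for all $(x,y)\in\Delta^\circ(I)$; the same formula defines $\Omega(x,y)$ for all $x,y\in I$. A map $N$ on $\Delta^\circ(I)$ is a (two-variable) mean if $x\le N(x,y)\le y$ for all $(x,y)\in\Delta^\circ(I)$, and a strict mean if $x<N(x,y)<y$ for all $(x,y)\in\Delta^\circ(I)$. "In its first variable" means for each fixed $(x,y)\in\Delta^\circ(I)$ as a function of $t\in T$. For $(x,y)\in\Delta^\circ(I)$, $$T'_{x,y}:=\{t\in T\mid\Lambda(t,x,y)>0,\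 M(t,x,y)<M_0(x,y)\},\qquad T''_{x,y}:=\{t\in T\mid\Lambda(t,x,y)>0,\ M(t,x,y)\ge M_0(x,y)\}.$$ *)

theory Defs
  imports "HOL-Analysis.Analysis"
begin

text \<open>
  Functions on the open triangle are curried, and only their values at points of the triangle
  are ever constrained or used.
\<close>

definition open_triangle :: "real set \<Rightarrow> (real \<times> real) set" where
  "open_triangle I = {(x, y). x \<in> I \<and> y \<in> I \<and> x < y}"

definition Omega :: "(real \<Rightarrow> real) \<Rightarrow> (real \<Rightarrow> real) \<Rightarrow> real \<Rightarrow> real \<Rightarrow> real" where
  "Omega \<omega>0 \<omega>1 x y = \<omega>0 x * \<omega>1 y - \<omega>0 y * \<omega>1 x"

definition chebyshev_system :: "real set \<Rightarrow> (real \<Rightarrow> real) \<Rightarrow> (real \<Rightarrow> real) \<Rightarrow> bool" where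
  "chebyshev_system I \<omega>0 \<omega>1 \<longleftrightarrow>
     continuous_on I \<omega>0 \<and> continuous_on I \<omega>1 \<and>
     (\<forall>(x, y) \<in> open_triangle I. Omega \<omega>0 \<omega>1 x y > 0)"

definition mean_on :: "real set \<Rightarrow> (real \<Rightarrow> real \<Rightarrow> real) \<Rightarrow> bool" where
  "mean_on I N \<longleftrightarrow> (\<forall>(x, y) \<in> open_triangle I. x \<le> N x y \<and> N x y \<le> y)"

definition strict_mean_on :: "real set \<Rightarrow> (real \<Rightarrow> real \<Rightarrow> real) \<Rightarrow> bool" where
  "strict_mean_on I N \<longleftrightarrow> (\<forall>(x, y) \<in> open_triangle I. x < N x y \<and> N x y < y)"

definition locally_upper_bounded_on :: "real set \<Rightarrow> (real \<Rightarrow> real) \<Rightarrow> bool" where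
  "locally_upper_bounded_on I f \<longleftrightarrow>
     (\<forall>p\<in>I. \<exists>U. open U \<and> p \<in> U \<and> bdd_above (f ` (U \<inter> I)))"

definition T_lower ::
  "'a measure \<Rightarrow> ('a \<Rightarrow> real \<Rightarrow> real \<Rightarrow> real) \<Rightarrow> ('a \<Rightarrow> real \<Rightarrow> real \<Rightarrow> real) \<Rightarrow>
   (real \<Rightarrow> real \<Rightarrow> real) \<Rightarrow> real \<Rightarrow> real \<Rightarrow> 'a set" where
  "T_lower \<mu> \<Lambda> M M0 x y = {t \<in> space \<mu>. \<Lambda> t x y > 0 \<and> M t x y < M0 x y}"

definition T_upper ::
  "'a measure \<Rightarrow> ('a \<Rightarrow> real \<Rightarrow> real \<Rightarrow> real) \<Rightarrow> ('a \<Rightarrow> real \<Rightarrow> real \<Rightarrow> real) \<Rightarrow>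
   (real \<Rightarrow> real \<Rightarrow> real) \<Rightarrow> real \<Rightarrow> real \<Rightarrow> 'a set" where
  "T_upper \<mu> \<Lambda> M M0 x y = {t \<in> space \<mu>. \<Lambda> t x y > 0 \<and> M t x y \<ge> M0 x y}"

text \<open>
  The measure need not be \<open>\<sigma>\<close>-finite, so double integrals are kept as iterated integrals, with
  the variable of \<open>A\<close> outermost.
\<close>

definition iterated_integral ::
  "'a measure \<Rightarrow> 'a set \<Rightarrow> 'a set \<Rightarrow> ('a \<Rightarrow> 'a \<Rightarrow> real) \<Rightarrow> real" where
  "iterated_integral \<mu> A B h = (LINT t:A|\<mu>. (LINT s:B|\<mu>. h t s))"

definition iterated_integrable ::
  "'a measure \<Rightarrow> 'a set \<Rightarrow> 'a set \<Rightarrow> ('a \<Rightarrow> 'a \<Rightarrow> real) \<Rightarrow> bool" where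
  "iterated_integrable \<mu> A B h \<longleftrightarrow>
     (\<forall>t\<in>A. set_integrable \<mu> B (h t)) \<and> set_integrable \<mu> A (\<lambda>t. LINT s:B|\<mu>. h t s)"

definition E_weight ::
  "('a \<Rightarrow> real \<Rightarrow> real \<Rightarrow> real) \<Rightarrow> ('a \<Rightarrow> real \<Rightarrow> real \<Rightarrow> real) \<Rightarrow>
   (real \<Rightarrow> real) \<Rightarrow> (real \<Rightarrow> real) \<Rightarrow> real \<Rightarrow> real \<Rightarrow> 'a \<Rightarrow> 'a \<Rightarrow> real" where
  "E_weight \<Lambda> M \<omega>0 \<omega>1 x y t s =
     \<Lambda> t x y * \<Lambda> s x y * Omega \<omega>0 \<omega>1 (M t x y) (M s x y)"

definition E_term ::
  "'a measure \<Rightarrow> ('a \<Rightarrow> real \<Rightarrow> real \<Rightarrow> real) \<Rightarrow> ('a \<Rightarrow> real \<Rightarrow> real \<Rightarrow> real) \<Rightarrow>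
   (real \<Rightarrow> real \<Rightarrow> real) \<Rightarrow> (real \<Rightarrow> real) \<Rightarrow> (real \<Rightarrow> real) \<Rightarrow>
   (real \<Rightarrow> real \<Rightarrow> real \<Rightarrow> real) \<Rightarrow> real \<Rightarrow> real \<Rightarrow> real" where
  "E_term \<mu> \<Lambda> M M0 \<omega>0 \<omega>1 \<epsilon> x y =
     iterated_integral \<mu> (T_lower \<mu> \<Lambda> M M0 x y) (T_upper \<mu> \<Lambda> M M0 x y)
       (\<lambda>t s. E_weight \<Lambda> M \<omega>0 \<omega>1 x y t s * \<epsilon> (M t x y) (M s x y) (M0 x y)) /
     iterated_integral \<mu> (T_lower \<mu> \<Lambda> M M0 x y) (T_upper \<mu> \<Lambda> M M0 x y)
       (E_weight \<Lambda> M \<omega>0 \<omega>1 x y)"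

text \<open>
  The Bochner integral of a non-integrable function and a quotient by zero are both \<open>0\<close> in HOL;
  the next predicate says that \<open>E_term\<close> has its ordinary meaning.
\<close>

definition E_well_defined ::
  "'a measure \<Rightarrow> ('a \<Rightarrow> real \<Rightarrow> real \<Rightarrow> real) \<Rightarrow> ('a \<Rightarrow> real \<Rightarrow> real \<Rightarrow> real) \<Rightarrow>
   (real \<Rightarrow> real \<Rightarrow> real) \<Rightarrow> (real \<Rightarrow> real) \<Rightarrow> (real \<Rightarrow> real) \<Rightarrow>
   (real \<Rightarrow> real \<Rightarrow> real \<Rightarrow> real) \<Rightarrow> real \<Rightarrow> real \<Rightarrow> bool" where
  "E_well_defined \<mu> \<Lambda> M M0 \<omega>0 \<omega>1 \<epsilon> x y \<longleftrightarrow>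
     iterated_integrable \<mu> (T_lower \<mu> \<Lambda> M M0 x y) (T_upper \<mu> \<Lambda> M M0 x y)
       (\<lambda>t s. E_weight \<Lambda> M \<omega>0 \<omega>1 x y t s * \<epsilon> (M t x y) (M s x y) (M0 x y)) \<and>
     iterated_integrable \<mu> (T_lower \<mu> \<Lambda> M M0 x y) (T_upper \<mu> \<Lambda> M M0 x y)
       (E_weight \<Lambda> M \<omega>0 \<omega>1 x y) \<and>
     iterated_integral \<mu> (T_lower \<mu> \<Lambda> M M0 x y) (T_upper \<mu> \<Lambda> M M0 x y)
       (E_weight \<Lambda> M \<omega>0 \<omega>1 x y) \<noteq> 0"

end

theory Submission
  imports Defs
begin

text \<open>
  Fix \<open>(x, y)\<close>, put \<open>u = M0 x y\<close>, and let \<open>N\<close> be the image under \<open>M(\<cdot>, x, y)\<close> of the measure with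
  density \<open>\<Lambda>(\<cdot>, x, y)\<close>. It is finite, so Fubini applies to it although \<open>\<mu>\<close> need not be
  \<open>\<sigma>\<close>-finite. Multiply the hypothesis on \<open>f\<close> at \<open>v < u \<le> w\<close> by \<open>\<Omega>(v, w)\<close> and integrate
  over \<open>N \<times> N\<close>. Since \<open>N\<close> and the point mass at \<open>u\<close> give the same integrals of \<open>\<omega>0\<close> and \<open>\<omega>1\<close>,
  the integrals of \<open>\<Omega>(v, u)\<close> over \<open>v < u\<close> and of \<open>\<Omega>(u, w)\<close> over \<open>w \<ge> u\<close> have a common value \<open>A\<close>.
  The identity \<open>\<omega>0(u) \<Omega>(v, w) = \<omega>0(v) \<Omega>(u, w) + \<omega>0(w) \<Omega>(v, u)\<close> shows that the
  denominator of \<open>E(x, y)\<close> is also \<open>A\<close>; dividing by \<open>A > 0\<close> gives the claim.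
\<close>

section \<open>Algebra and bounds for the Chebyshev determinant\<close>

text \<open>Expand along its first row the determinant with rows \<open>\<omega>0\<close>,
  \<open>\<omega>0\<close>, \<open>\<omega>1\<close> and columns at \<open>u\<close>,
  \<open>v\<close>, \<open>w\<close>; it vanishes because two rows agree.\<close>

lemma Omega_three_point:
  "\<omega>0 u * Omega \<omega>0 \<omega>1 v w = \<omega>0 v * Omega \<omega>0 \<omega>1 u w + \<omega>0 w * Omega \<omega>0 \<omega>1 v u"
  by (simp add: Omega_def algebra_simps)

lemma Omega_swap: "Omega \<omega>0 \<omega>1 v w = - Omega \<omega>0 \<omega>1 w v"
  by (simp add: Omega_def)

lemma Omega_self [simp]: "Omega \<omega>0 \<omega>1 v v = 0"
  by (simp add: Omega_def)

lemma Omega_measurable [measurable]: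
  assumes [measurable]: "\<omega>0 \<in> borel_measurable borel" "\<omega>1 \<in> borel_measurable borel"
    and [measurable]: "a \<in> borel_measurable Q" "b \<in> borel_measurable Q"
  shows "(\<lambda>z. Omega \<omega>0 \<omega>1 (a z) (b z)) \<in> borel_measurable Q"
  unfolding Omega_def by measurable

lemma Omega_bounded:
  assumes "\<And>v. \<bar>\<omega>0 v\<bar> \<le> C" "\<And>v. \<bar>\<omega>1 v\<bar> \<le> C"
  shows "\<bar>Omega \<omega>0 \<omega>1 v w\<bar> \<le> 2 * C * C"
proof -
  have "0 \<le> C" using assms(1)[of v] by linarith
  then have "\<bar>\<omega>0 v * \<omega>1 w\<bar> \<le> C * C" "\<bar>\<omega>0 w * \<omega>1 v\<bar> \<le> C * C"
    using assms by (auto simp: abs_mult intro!: mult_mono)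
  then show ?thesis
    unfolding Omega_def by linarith
qed

section \<open>The inequality for a finite Borel measure on the line\<close>

text \<open>This is the analytic core, stated for globally defined bounded Borel functions so that
  every integrand is integrable over a finite measure. \<open>H (v, w)\<close> stands for the
  determinant at \<open>(v, w)\<close> times the error term, which keeps denominators out of
  \<open>ineq\<close>. \<open>R\<close> is open on the left factor and closed on the right one at
  \<open>u\<close>, matching the two sets over which \<open>E_term\<close> integrates.\<close>

lemma Jensen_finite_measure:
  fixes N :: "real measure" and w0 w1 g :: "real \<Rightarrow> real" and H :: "real \<times> real \<Rightarrow> real"
  assumes fin: "finite_measure N" and sets_N [measurable_cong]: "sets N = sets borel"
    and [measurable]: "w0 \<in> borel_measurable borel" "w1 \<in> borel_measurable borel"
      "g \<in> borel_measurable borel" "H \<in> borel_measurable borel"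
    and w0_bound: "\<And>v. \<bar>w0 v\<bar> \<le> C" and w1_bound: "\<And>v. \<bar>w1 v\<bar> \<le> C"
    and g_bound: "\<And>v. \<bar>g v\<bar> \<le> C" and H_bound: "\<And>z. \<bar>H z\<bar> \<le> C"
    and w0_int: "(LINT v|N. w0 v) = w0 u" and w1_int: "(LINT v|N. w1 v) = w1 u"
    and w0_pos: "w0 u > 0"
    and lower: "\<And>v. v < u \<Longrightarrow> 0 \<le> Omega w0 w1 v u"
    and upper: "\<And>w. u \<le> w \<Longrightarrow> 0 \<le> Omega w0 w1 u w"
    and nondeg: "\<not> (AE v in N. Omega w0 w1 v u = 0)"
    and ineq: "\<And>v w. v < u \<Longrightarrow> u \<le> w \<Longrightarrow>
      Omega w0 w1 v w * g u \<le> Omega w0 w1 u w * g v + Omega w0 w1 v u * g w + H (v, w)"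
  defines "R \<equiv> {..<u} \<times> {u..}"
  defines "D \<equiv> (LINT v|N. LINT w|N. indicator R (v, w) * Omega w0 w1 v w)"
  shows "D > 0"
    and "g u \<le> (LINT v|N. g v) + (LINT v|N. LINT w|N. indicator R (v, w) * H (v, w)) / D"
proof -
  interpret N: finite_measure N by (rule fin)
  interpret P: pair_sigma_finite N N ..
  interpret NN: finite_measure "N \<Otimes>\<^sub>M N"
    by (rule finite_measure_pair_measure) (rule fin)+
  have H_pair [measurable]: "H \<in> borel_measurable (borel \<Otimes>\<^sub>M borel)"
    using \<open>H \<in> borel_measurable borel\<close> by (simp add: borel_prod)
  have R_meas [measurable]: "R \<in> sets (borel \<Otimes>\<^sub>M borel)"
    unfolding R_def by measurable
  have C0: "0 \<le> C" using w0_bound[of u] by linarith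
  have O_bound: "\<bar>Omega w0 w1 v w\<bar> \<le> 2 * C * C" for v w
    by (rule Omega_bounded[OF w0_bound w1_bound])
  have int1: "integrable N h" if "h \<in> borel_measurable borel" "\<And>v. \<bar>h v\<bar> \<le> B"
    for h :: "real \<Rightarrow> real" and B
    using that by (intro N.integrable_const_bound[where B = B]) (auto simp: measurable_cong_sets[OF sets_N refl])
  have int2: "integrable (N \<Otimes>\<^sub>M N) h"
    if "h \<in> borel_measurable (borel \<Otimes>\<^sub>M borel)" "\<And>z. \<bar>h z\<bar> \<le> B"
    for h :: "real \<times> real \<Rightarrow> real" and B
    using that by (intro NN.integrable_const_bound[where B = B])
      (auto simp: measurable_cong_sets[OF sets_pair_measure_cong[OF sets_N sets_N] refl])
  \<comment> \<open>The indicator of \<open>R\<close> factors as \<open>p v * q w\<close>, so double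
    integrals of functions with separated variables become products of single ones.\<close>
  define p q :: "real \<Rightarrow> real" where "p = indicator {..<u}" and "q = indicator {u..}"
  have [measurable]: "p \<in> borel_measurable borel" "q \<in> borel_measurable borel"
    unfolding p_def q_def by measurable
  have pq: "p v + q v = 1" "indicator R (v, w) = p v * q w" for v w
    by (auto simp: p_def q_def R_def indicator_def)
  have pb: "\<bar>p v * a\<bar> \<le> \<bar>a\<bar>" "\<bar>q v * a\<bar> \<le> \<bar>a\<bar>" for v a
    by (auto simp: p_def q_def indicator_def)
  have ip: "integrable N (\<lambda>v. p v * h v)" and iq: "integrable N (\<lambda>v. q v * h v)" and i: "integrable N h"
    if "h \<in> borel_measurable borel" "\<And>v. \<bar>h v\<bar> \<le> B" for h :: "real \<Rightarrow> real" and B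
    using that by (auto intro!: int1[where B = B] intro: order_trans[OF pb(1)] order_trans[OF pb(2)])
  have split_int: "(LINT v|N. h v) = (LINT v|N. p v * h v) + (LINT v|N. q v * h v)"
    if "h \<in> borel_measurable borel" "\<And>v. \<bar>h v\<bar> \<le> B" for h :: "real \<Rightarrow> real" and B
  proof -
    have "(LINT v|N. h v) = (LINT v|N. p v * h v + q v * h v)"
      by (simp add: pq(1) flip: distrib_right)
    also have "\<dots> = (LINT v|N. p v * h v) + (LINT v|N. q v * h v)"
      using that by (intro Bochner_Integration.integral_add ip[where B = B] iq[where B = B])
    finally show ?thesis .
  qed
  define A where "A = (LINT v|N. p v * Omega w0 w1 v u)"
  have Om [measurable]: "(\<lambda>v. Omega w0 w1 v u) \<in> borel_measurable borel"
    "(\<lambda>v. Omega w0 w1 u v) \<in> borel_measurable borel" by measurable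
  \<comment> \<open>By linearity in the second argument, \<open>w0_int\<close> and
    \<open>w1_int\<close> turn this integral into \<open>Omega w0 w1 u u = 0\<close>. Splitting it
    at \<open>u\<close> then shows that both halves have the same absolute value
    \<open>A\<close>.\<close>
  have "(LINT v|N. Omega w0 w1 u v) = w0 u * (LINT v|N. w1 v) - (LINT v|N. w0 v) * w1 u"
    unfolding Omega_def
    using i[of w0 C] i[of w1 C] w0_bound w1_bound
    by simp
  then have "(LINT v|N. Omega w0 w1 u v) = 0"
    by (simp add: w0_int w1_int)
  then have "(LINT v|N. p v * Omega w0 w1 u v) + (LINT v|N. q v * Omega w0 w1 u v) = 0"
    using split_int[OF Om(2) O_bound] by simp
  moreover have "(LINT v|N. p v * Omega w0 w1 u v) = - A"
    unfolding A_def by (subst Omega_swap) simp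
  ultimately have A_upper: "(LINT v|N. q v * Omega w0 w1 u v) = A"
    by simp
  have pO: "0 \<le> p v * Omega w0 w1 v u" and qO: "0 \<le> q v * Omega w0 w1 u v" for v
    using lower[of v] upper[of v] by (auto simp: p_def q_def indicator_def)
  \<comment> \<open>If \<open>A\<close> were \<open>0\<close>, the nonnegative integrands on both
    sides of \<open>u\<close> would vanish almost everywhere, against \<open>nondeg\<close>.\<close>
  have "A \<noteq> 0"
  proof
    assume "A = 0"
    have "AE v in N. p v * Omega w0 w1 v u = 0"
      using \<open>A = 0\<close> integral_nonneg_eq_0_iff_AE[OF ip[OF Om(1) O_bound]] pO
      by (simp add: A_def)
    moreover have "AE v in N. q v * Omega w0 w1 u v = 0"
      using \<open>A = 0\<close> A_upper integral_nonneg_eq_0_iff_AE[OF iq[OF Om(2) O_bound]] qO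
      by simp
    ultimately have "AE v in N. Omega w0 w1 v u = 0"
    proof eventually_elim
      case (elim v)
      then show ?case
        using Omega_swap[of w0 w1 u v] by (auto simp: p_def q_def indicator_def split: if_splits)
    qed
    with nondeg show False by simp
  qed
  moreover have "0 \<le> A"
    unfolding A_def using pO by (intro integral_nonneg_AE) auto
  ultimately have "A > 0" by simp
  define J where "J = (\<lambda>h :: real \<times> real \<Rightarrow> real. LINT z|(N \<Otimes>\<^sub>M N). h z)"
  have J_iter: "J h = (LINT v|N. LINT w|N. h (v, w))"
    if "integrable (N \<Otimes>\<^sub>M N) h" for h
    unfolding J_def using P.integral_fst'[OF that] by simp
  have prod_bound: "\<bar>a * b\<bar> \<le> B * B'" if "\<bar>a\<bar> \<le> B" "\<bar>b\<bar> \<le> B'" for a b B B' :: real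
    using that by (auto simp: abs_mult intro!: mult_mono)
  \<comment> \<open>Both kernels have separated variables: \<open>K1 h\<close> integrates to
    \<open>A\<close> times the integral of \<open>h\<close> over \<open>v < u\<close>, and
    \<open>K2 h\<close> to \<open>A\<close> times that over \<open>w \<ge> u\<close>. Together they
    give \<open>A\<close> times the full integral of \<open>h\<close>. This is used for
    \<open>h = w0\<close> (equality) and for \<open>h = g\<close> (inequality).\<close>
  define K1 K2 where
    "K1 = (\<lambda>h z. (p (fst z) * h (fst z)) * (q (snd z) * Omega w0 w1 u (snd z)))" and
    "K2 = (\<lambda>h z. (p (fst z) * Omega w0 w1 (fst z) u) * (q (snd z) * h (snd z)))"
  have K: "integrable (N \<Otimes>\<^sub>M N) (K1 h)" "integrable (N \<Otimes>\<^sub>M N) (K2 h)"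
      "J (K1 h) + J (K2 h) = A * (LINT v|N. h v)"
    if [measurable]: "h \<in> borel_measurable borel" and hb: "\<And>v. \<bar>h v\<bar> \<le> C" for h
  proof -
    have 1: "integrable (N \<Otimes>\<^sub>M N) (K1 h)" unfolding K1_def
      by (rule int2[where B = "C * (2 * C * C)"], measurable)
        (intro prod_bound order_trans[OF pb(1)] order_trans[OF pb(2)] hb O_bound)
    have 2: "integrable (N \<Otimes>\<^sub>M N) (K2 h)" unfolding K2_def
      by (rule int2[where B = "(2 * C * C) * C"], measurable)
        (intro prod_bound order_trans[OF pb(1)] order_trans[OF pb(2)] hb O_bound)
    have "J (K1 h) = (LINT v|N. p v * h v) * A"
      by (simp add: J_iter[OF 1]) (simp add: K1_def A_upper)
    moreover have "J (K2 h) = A * (LINT v|N. q v * h v)"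
      by (simp add: J_iter[OF 2]) (simp add: K2_def A_def)
    ultimately show "J (K1 h) + J (K2 h) = A * (LINT v|N. h v)"
      using split_int[OF that] by (simp add: algebra_simps)
    show "integrable (N \<Otimes>\<^sub>M N) (K1 h)" "integrable (N \<Otimes>\<^sub>M N) (K2 h)" by fact+
  qed
  define GO GH where "GO = (\<lambda>z. indicator R z * Omega w0 w1 (fst z) (snd z))"
    and "GH = (\<lambda>z. indicator R z * H z)"
  have iGO: "integrable (N \<Otimes>\<^sub>M N) GO" unfolding GO_def
    by (rule int2[where B = "2 * C * C"], measurable)
      (use O_bound C0 in \<open>auto simp: indicator_def\<close>)
  have iGH: "integrable (N \<Otimes>\<^sub>M N) GH" unfolding GH_def
    by (rule int2[where B = C], measurable)
      (use H_bound C0 in \<open>auto simp: indicator_def\<close>)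
  have D: "D = J GO"
    using J_iter[OF iGO] by (simp add: D_def GO_def)
  \<comment> \<open>The case \<open>h = w0\<close>: integrating the three-point identity gives
    \<open>w0 u * D = A * w0 u\<close>, and \<open>w0 u\<close> cancels.\<close>
  have "w0 u * GO z = K1 w0 z + K2 w0 z" for z
  proof -
    obtain v w where z: "z = (v, w)" by (cases z)
    have "w0 u * GO z = p v * q w * (w0 u * Omega w0 w1 v w)"
      by (simp add: z GO_def pq)
    also have "\<dots> = K1 w0 z + K2 w0 z"
      by (subst Omega_three_point) (simp add: z K1_def K2_def algebra_simps)
    finally show ?thesis .
  qed
  then have "w0 u * J GO = J (\<lambda>z. K1 w0 z + K2 w0 z)"
    using iGO by (simp add: J_def flip: integral_mult_right_zero)
  also have "\<dots> = J (K1 w0) + J (K2 w0)"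
    unfolding J_def using K[of w0] w0_bound by (intro Bochner_Integration.integral_add) auto
  also have "\<dots> = A * w0 u"
    using K(3)[of w0] w0_bound w0_int by simp
  finally have "D = A"
    using w0_pos D by simp
  then show "D > 0" using \<open>A > 0\<close> by simp
  \<comment> \<open>The case \<open>h = g\<close>. Off \<open>R\<close>, where \<open>ineq\<close>
    says nothing, all terms vanish.\<close>
  have "g u * GO z \<le> K1 g z + K2 g z + GH z" for z
  proof -
    obtain v w where z: "z = (v, w)" by (cases z)
    have "p v * q w * (Omega w0 w1 v w * g u) \<le>
      p v * q w * (Omega w0 w1 u w * g v + Omega w0 w1 v u * g w + H (v, w))"
      using ineq[of v w] by (auto simp: p_def q_def indicator_def)
    then show ?thesis
      by (simp add: z GO_def GH_def pq(2) K1_def K2_def algebra_simps)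
  qed
  then have "J (\<lambda>z. g u * GO z) \<le> J (\<lambda>z. K1 g z + K2 g z + GH z)"
    unfolding J_def using iGO iGH K[of g] g_bound by (intro integral_mono) auto
  also have "\<dots> = J (K1 g) + J (K2 g) + J GH"
    unfolding J_def using iGH K(1,2)[of g] g_bound by simp
  also have "\<dots> = A * (LINT v|N. g v) + J GH"
    using K(3)[of g] g_bound by simp
  finally have "g u * A \<le> A * (LINT v|N. g v) + J GH"
    using D \<open>D = A\<close> by (simp add: J_def)
  then have "g u \<le> (LINT v|N. g v) + J GH / D"
    using \<open>A > 0\<close> \<open>D = A\<close> by (simp add: field_simps)
  then show "g u \<le> (LINT v|N. g v) + (LINT v|N. LINT w|N. indicator R (v, w) * H (v, w)) / D"
    using J_iter[OF iGH] by (simp add: GH_def)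
qed

section \<open>Transfer of integrals to the image measure\<close>

lemma finite_measure_density_integrable:
  fixes l :: "'a \<Rightarrow> real"
  assumes "integrable \<mu> l" "\<And>t. t \<in> space \<mu> \<Longrightarrow> 0 \<le> l t"
  shows "finite_measure (density \<mu> l)"
proof (rule finite_measureI)
  have [measurable]: "l \<in> borel_measurable \<mu>" using assms(1) by auto
  have "emeasure (density \<mu> l) (space (density \<mu> l)) = (\<integral>\<^sup>+t. l t \<partial>\<mu>)"
    by (auto simp: emeasure_density intro!: nn_integral_cong)
  also have "\<dots> = ennreal (LINT t|\<mu>. l t)"
    using assms by (intro nn_integral_eq_integral) auto
  finally show "emeasure (density \<mu> l) (space (density \<mu> l)) \<noteq> \<infinity>" by simp
qed

lemma
  fixes l m :: "'a \<Rightarrow> real" and h :: "real \<Rightarrow> real"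
  assumes [measurable]: "l \<in> borel_measurable \<mu>" "m \<in> borel_measurable \<mu>" "h \<in> borel_measurable borel"
    and nonneg: "\<And>t. t \<in> space \<mu> \<Longrightarrow> 0 \<le> l t"
  defines "N \<equiv> distr (density \<mu> l) borel m"
  shows integral_distr_density: "(LINT v|N. h v) = (LINT t|\<mu>. l t * h (m t))"
    and integrable_distr_density: "integrable N h \<longleftrightarrow> integrable \<mu> (\<lambda>t. l t * h (m t))"
  using nonneg
  by (simp_all add: N_def integral_distr integral_real_density integrable_distr_eq integrable_real_density)

text \<open>Two successive changes of variables, one for each integral, so no product of
  \<open>\<mu>\<close> with itself is formed. \<open>K\<close> is prescribed only where
  \<open>m t < u \<le> m s\<close>, since the error term is controlled only at such pairs.\<close>

lemma iterated_integral_distr_density: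
  fixes l m :: "'a \<Rightarrow> real" and G :: "real \<times> real \<Rightarrow> real"
  assumes l: "integrable \<mu> l" and nonneg: "\<And>t. t \<in> space \<mu> \<Longrightarrow> 0 \<le> l t"
    and m [measurable]: "m \<in> borel_measurable \<mu>" and G: "G \<in> borel_measurable borel"
    and G_bound: "\<And>z. \<bar>G z\<bar> \<le> C"
    and K: "\<And>t s. t \<in> space \<mu> \<Longrightarrow> s \<in> space \<mu> \<Longrightarrow> m t < u \<Longrightarrow> u \<le> m s \<Longrightarrow>
      K t s = l t * (l s * G (m t, m s))"
    and G_zero: "\<And>v w. \<not> (v < u \<and> u \<le> w) \<Longrightarrow> G (v, w) = 0"
  defines "N \<equiv> distr (density \<mu> l) borel m"
    and "A \<equiv> {t \<in> space \<mu>. l t > 0 \<and> m t < u}" and "B \<equiv> {t \<in> space \<mu>. l t > 0 \<and> m t \<ge> u}"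
  shows "iterated_integrable \<mu> A B K"
    and "iterated_integral \<mu> A B K = (LINT v|N. LINT w|N. G (v, w))"
proof -
  have [measurable]: "l \<in> borel_measurable \<mu>" using l by auto
  have G' [measurable]: "G \<in> borel_measurable (borel \<Otimes>\<^sub>M borel)"
    using G by (simp add: borel_prod)
  have sets_N [measurable_cong]: "sets N = sets borel" by (simp add: N_def)
  interpret N: finite_measure N
    unfolding N_def
    by (intro finite_measure.finite_measure_distr finite_measure_density_integrable l nonneg) auto
  interpret P: pair_sigma_finite N N ..
  interpret NN: finite_measure "N \<Otimes>\<^sub>M N"
    by (rule finite_measure_pair_measure) unfold_locales
  have G_int: "integrable (N \<Otimes>\<^sub>M N) G"
    using G_bound by (intro NN.integrable_const_bound[where B = C]) auto
  define g where "g v = (LINT w|N. G (v, w))" for v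
  \<comment> \<open>Fubini on \<open>N \<Otimes>\<^sub>M N\<close> also yields the measurability of
    the inner integral in the outer variable.\<close>
  have g_int: "integrable N g"
    unfolding g_def using P.integrable_fst'[OF G_int] .
  then have [measurable]: "g \<in> borel_measurable borel"
    by (auto simp: measurable_cong_sets[OF sets_N refl] dest!: borel_measurable_integrable)
  \<comment> \<open>Boundedness of \<open>G\<close> gives this for every \<open>v\<close>, not just
    almost every one, as \<open>iterated_integrable\<close> demands.\<close>
  have inner_int: "integrable N (\<lambda>w. G (v, w))" for v
    using G_bound by (intro N.integrable_const_bound[where B = C]) auto
  have inner: "integrable \<mu> (\<lambda>s. l s * G (v, m s))" "(LINT s|\<mu>. l s * G (v, m s)) = g v" for v
    using inner_int[of v] integrable_distr_density[of l \<mu> m "\<lambda>w. G (v, w)"]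
      integral_distr_density[of l \<mu> m "\<lambda>w. G (v, w)"] nonneg
    by (auto simp: N_def g_def)
  \<comment> \<open>Restricting to \<open>B\<close> loses nothing: at a point of the space outside
    \<open>B\<close> either the weight \<open>l s\<close> is zero or \<open>m s < u\<close>, and
    then \<open>G\<close> vanishes. The same reasoning serves \<open>A\<close> in
    \<open>outer_eq\<close>.\<close>
  have inner_eq: "indicat_real B s *\<^sub>R K t s = l t * (l s * G (m t, m s))"
    if "t \<in> A" "s \<in> space \<mu>" for t s
  proof (cases "s \<in> B")
    case True
    with that K[of t s] show ?thesis by (auto simp: A_def B_def)
  next
    case False
    with that nonneg[of s] have "l s = 0 \<or> m s < u" by (force simp: B_def)
    with False G_zero[of "m t" "m s"] show ?thesis by auto
  qed
  have inner_set: "set_integrable \<mu> B (K t)" "(LINT s:B|\<mu>. K t s) = l t * g (m t)" if "t \<in> A" for t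
  proof -
    show "set_integrable \<mu> B (K t)"
      unfolding set_integrable_def
      using inner(1)[of "m t"] inner_eq[OF that]
      by (subst Bochner_Integration.integrable_cong[OF refl inner_eq[OF that]]) auto
    show "(LINT s:B|\<mu>. K t s) = l t * g (m t)"
      unfolding set_lebesgue_integral_def
      by (subst Bochner_Integration.integral_cong[OF refl inner_eq[OF that]]) (auto simp: inner(2))
  qed
  have outer_eq: "indicat_real A t *\<^sub>R (LINT s:B|\<mu>. K t s) = l t * g (m t)" if "t \<in> space \<mu>" for t
  proof (cases "t \<in> A")
    case True
    then show ?thesis by (simp add: inner_set)
  next
    case False
    with that nonneg[of t] have "l t = 0 \<or> u \<le> m t" by (force simp: A_def)
    then have "l t * g (m t) = 0" using G_zero[of "m t"] by (auto simp: g_def)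
    with False show ?thesis by simp
  qed
  have "integrable \<mu> (\<lambda>t. l t * g (m t))"
    using g_int integrable_distr_density[of l \<mu> m g] nonneg by (auto simp: N_def)
  then have "set_integrable \<mu> A (\<lambda>t. LINT s:B|\<mu>. K t s)"
    unfolding set_integrable_def
    by (subst Bochner_Integration.integrable_cong[OF refl outer_eq]) auto
  then show "iterated_integrable \<mu> A B K"
    using inner_set by (auto simp: iterated_integrable_def)
  have "iterated_integral \<mu> A B K = (LINT t|\<mu>. l t * g (m t))"
    unfolding iterated_integral_def set_lebesgue_integral_def[of \<mu> A]
    by (rule Bochner_Integration.integral_cong[OF refl outer_eq])
  also have "\<dots> = (LINT v|N. g v)"
    using integral_distr_density[of l \<mu> m g] nonneg by (auto simp: N_def)
  finally show "iterated_integral \<mu> A B K = (LINT v|N. LINT w|N. G (v, w))"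
    by (simp add: g_def)
qed

section \<open>Boundedness on compact intervals\<close>

text \<open>Finitely many of the neighbourhoods cover \<open>S\<close>, and a finite union of sets
  bounded above is bounded above.\<close>

lemma locally_upper_bounded_on_compact:
  assumes "locally_upper_bounded_on I f" "compact S" "S \<subseteq> I"
  shows "bdd_above (f ` S)"
proof -
  obtain U where U: "\<And>p. p \<in> I \<Longrightarrow> open (U p) \<and> p \<in> U p \<and> bdd_above (f ` (U p \<inter> I))"
    using assms(1) unfolding locally_upper_bounded_on_def by metis
  obtain F where F: "F \<subseteq> S" "finite F" "S \<subseteq> (\<Union>p\<in>F. U p)"
    by (rule compactE_image[OF assms(2), of S U]) (use U assms(3) in blast)+
  have "bdd_above (\<Union>p\<in>F. f ` (U p \<inter> I))"
    using U F(1) assms(3) by (auto simp: bdd_above_UN[OF F(2)])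
  moreover have "f ` S \<subseteq> (\<Union>p\<in>F. f ` (U p \<inter> I))"
    using F assms(3) by fastforce
  ultimately show ?thesis by (rule bdd_above_mono)
qed

lemma compact_abs_bound:
  fixes h :: "real \<Rightarrow> real"
  assumes "continuous_on {x..y} h"
  obtains C where "\<And>v. v \<in> {x..y} \<Longrightarrow> \<bar>h v\<bar> \<le> C"
proof -
  have "bounded (h ` {x..y})"
    by (rule compact_imp_bounded[OF compact_continuous_image[OF assms compact_Icc]])
  then show thesis
    using that unfolding bounded_real by blast
qed

text \<open>For \<open>v \<le> u\<close> take \<open>w = y\<close> in \<open>ineq\<close> and solve
  for \<open>f v\<close>: its coefficient \<open>Omega \<omega>0 \<omega>1 u y\<close> is positive
  and independent of \<open>v\<close>, and all other terms are bounded. For \<open>v > u\<close>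
  pair it with \<open>x\<close> instead, where the coefficient is
  \<open>Omega \<omega>0 \<omega>1 x u\<close>.\<close>

lemma upper_bounded_imp_bounded:
  assumes w_bound: "\<And>v. v \<in> {x..y} \<Longrightarrow> \<bar>Omega \<omega>0 \<omega>1 v y\<bar> \<le> C"
      "\<And>v. v \<in> {x..y} \<Longrightarrow> \<bar>Omega \<omega>0 \<omega>1 x v\<bar> \<le> C"
      "\<And>v. v \<in> {x..y} \<Longrightarrow> \<bar>Omega \<omega>0 \<omega>1 v u\<bar> \<le> C"
    and u: "x < u" "u < y"
    and pos: "Omega \<omega>0 \<omega>1 x u > 0" "Omega \<omega>0 \<omega>1 u y > 0"
    and ineq: "\<And>v w. v \<in> {x..u} \<Longrightarrow> w \<in> {u..y} \<Longrightarrow> v < w \<Longrightarrow>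
      Omega \<omega>0 \<omega>1 v w * f u \<le>
        Omega \<omega>0 \<omega>1 u w * f v + Omega \<omega>0 \<omega>1 v u * f w + Omega \<omega>0 \<omega>1 v w * e v w"
    and e_bound: "\<And>v w. v \<in> {x..u} \<Longrightarrow> w \<in> {u..y} \<Longrightarrow> v < w \<Longrightarrow> \<bar>e v w\<bar> \<le> C"
    and upper: "\<And>v. v \<in> {x..y} \<Longrightarrow> f v \<le> C"
  obtains B where "\<And>v. v \<in> {x..y} \<Longrightarrow> \<bar>f v\<bar> \<le> B"
proof -
  have C0: "0 \<le> C" using w_bound(1)[of x] u by auto
  \<comment> \<open>\<open>K\<close> dominates the sum of all terms other than the one containing
    the unknown value; it lists both endpoint terms so as to serve both cases.\<close>
  define K where "K = C * \<bar>f u\<bar> + C * C + C * \<bar>f x\<bar> + C * \<bar>f y\<bar>"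
  have b: "\<bar>a * c\<bar> \<le> C * \<bar>c\<bar>" if "\<bar>a\<bar> \<le> C" for a c :: real
    using that by (auto simp: abs_mult intro!: mult_right_mono)
  have bC: "\<bar>a * c\<bar> \<le> C * C" if "\<bar>a\<bar> \<le> C" "\<bar>c\<bar> \<le> C" for a c :: real
    using that C0 by (auto simp: abs_mult intro!: mult_mono)
  have nn: "0 \<le> C * \<bar>f x\<bar>" "0 \<le> C * \<bar>f y\<bar>" using C0 by auto
  have K0: "0 \<le> K" unfolding K_def using C0 by auto
  define B where "B = C + K / Omega \<omega>0 \<omega>1 u y + K / Omega \<omega>0 \<omega>1 x u"
  have "\<bar>f v\<bar> \<le> B" if v: "v \<in> {x..y}" for v
  proof (cases "v \<le> u")
    case True
    then have "Omega \<omega>0 \<omega>1 v y * f u \<le>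
        Omega \<omega>0 \<omega>1 u y * f v + Omega \<omega>0 \<omega>1 v u * f y + Omega \<omega>0 \<omega>1 v y * e v y"
      using v u by (intro ineq) auto
    moreover have "\<bar>Omega \<omega>0 \<omega>1 v y * f u\<bar> \<le> C * \<bar>f u\<bar>" "\<bar>Omega \<omega>0 \<omega>1 v u * f y\<bar> \<le> C * \<bar>f y\<bar>"
      "\<bar>Omega \<omega>0 \<omega>1 v y * e v y\<bar> \<le> C * C"
      using v u True by (auto intro!: b bC w_bound e_bound)
    ultimately have "- K \<le> Omega \<omega>0 \<omega>1 u y * f v"
      using nn unfolding K_def by linarith
    then have "- (K / Omega \<omega>0 \<omega>1 u y) \<le> f v"
      using pos by (simp add: field_simps)
    moreover have "0 \<le> K / Omega \<omega>0 \<omega>1 u y" "0 \<le> K / Omega \<omega>0 \<omega>1 x u"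
      using pos K0 by auto
    ultimately show ?thesis using upper[OF v] C0 unfolding B_def by linarith
  next
    case False
    then have "Omega \<omega>0 \<omega>1 x v * f u \<le>
        Omega \<omega>0 \<omega>1 u v * f x + Omega \<omega>0 \<omega>1 x u * f v + Omega \<omega>0 \<omega>1 x v * e x v"
      using v u by (intro ineq) auto
    moreover have "\<bar>Omega \<omega>0 \<omega>1 x v * f u\<bar> \<le> C * \<bar>f u\<bar>" "\<bar>Omega \<omega>0 \<omega>1 u v * f x\<bar> \<le> C * \<bar>f x\<bar>"
      "\<bar>Omega \<omega>0 \<omega>1 x v * e x v\<bar> \<le> C * C"
      using v u False w_bound(3)[OF v] Omega_swap[of \<omega>0 \<omega>1 u v]
      by (auto intro!: b bC w_bound e_bound)
    ultimately have "- K \<le> Omega \<omega>0 \<omega>1 x u * f v"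
      using nn unfolding K_def by linarith
    then have "- (K / Omega \<omega>0 \<omega>1 x u) \<le> f v"
      using pos by (simp add: field_simps)
    moreover have "0 \<le> K / Omega \<omega>0 \<omega>1 u y" "0 \<le> K / Omega \<omega>0 \<omega>1 x u"
      using pos K0 by auto
    ultimately show ?thesis using upper[OF v] C0 unfolding B_def by linarith
  qed
  then show thesis by (rule that)
qed

section \<open>The integral inequality for general means\<close>

theorem theorem2:
  fixes I :: "real set"
    and \<mu> :: "'a measure"
    and \<Lambda> M :: "'a \<Rightarrow> real \<Rightarrow> real \<Rightarrow> real"
    and M0 :: "real \<Rightarrow> real \<Rightarrow> real"
    and \<omega>0 \<omega>1 f :: "real \<Rightarrow> real"
    and \<epsilon> :: "real \<Rightarrow> real \<Rightarrow> real \<Rightarrow> real"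
  assumes I: "is_interval I" "open I" "I \<noteq> {}"
    and Lambda_nonneg: "\<forall>t\<in>space \<mu>. \<forall>(x, y)\<in>open_triangle I. \<Lambda> t x y \<ge> 0"
    and Lambda_integrable: "\<forall>(x, y)\<in>open_triangle I. integrable \<mu> (\<lambda>t. \<Lambda> t x y)"
    and M_measurable: "\<forall>(x, y)\<in>open_triangle I. (\<lambda>t. M t x y) \<in> borel_measurable \<mu>"
    and M_mean: "\<forall>t\<in>space \<mu>. mean_on I (M t)"
    and M0_strict_mean: "\<forall>(x, y)\<in>open_triangle I. M0 x y \<in> I" "strict_mean_on I M0"
    and M_neq_M0: "\<forall>(x, y)\<in>open_triangle I.
        emeasure \<mu> {t \<in> space \<mu>. \<Lambda> t x y > 0 \<and> M t x y \<noteq> M0 x y} > 0"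
    and chebyshev: "chebyshev_system I \<omega>0 \<omega>1"
    and omega0_pos: "\<forall>x\<in>I. \<omega>0 x > 0"
    and omega0_eq: "\<forall>(x, y)\<in>open_triangle I. \<omega>0 (M0 x y) = (LINT t|\<mu>. \<Lambda> t x y * \<omega>0 (M t x y))"
    and omega1_eq: "\<forall>(x, y)\<in>open_triangle I. \<omega>1 (M0 x y) = (LINT t|\<mu>. \<Lambda> t x y * \<omega>1 (M t x y))"
    and f_locally_upper_bounded: "locally_upper_bounded_on I f"
    and f_measurable: "f \<in> borel_measurable (restrict_space borel I)"
    and f_ineq: "\<forall>(x, y)\<in>open_triangle I. \<forall>u\<in>{x..y}.
        f u \<le> Omega \<omega>0 \<omega>1 u y / Omega \<omega>0 \<omega>1 x y * f x
              + Omega \<omega>0 \<omega>1 x u / Omega \<omega>0 \<omega>1 x y * f y + \<epsilon> x y u"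
    and eps_bounded: "\<forall>(x, y)\<in>open_triangle I. \<forall>u\<in>{x<..<y}.
        bounded ((\<lambda>(v, w). \<epsilon> v w u) ` {(v, w). v \<in> {x..u} \<and> w \<in> {u..y} \<and> v < w})"
    and eps_measurable: "\<forall>(x, y)\<in>open_triangle I. \<forall>u\<in>{x<..<y}.
        (\<lambda>(v, w). \<epsilon> v w u) \<in> borel_measurable
          (restrict_space borel {(v, w). v \<in> {x..u} \<and> w \<in> {u..y} \<and> v < w})"
  shows "\<forall>(x, y)\<in>open_triangle I.
        integrable \<mu> (\<lambda>t. \<Lambda> t x y * f (M t x y)) \<and>
        E_well_defined \<mu> \<Lambda> M M0 \<omega>0 \<omega>1 \<epsilon> x y \<and>
        f (M0 x y) \<le> (LINT t|\<mu>. \<Lambda> t x y * f (M t x y)) + E_term \<mu> \<Lambda> M M0 \<omega>0 \<omega>1 \<epsilon> x y"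
proof safe
  fix x y assume xy: "(x, y) \<in> open_triangle I"
  then have xI: "x \<in> I" and yI: "y \<in> I" and "x < y" by (auto simp: open_triangle_def)
  define u where "u = M0 x y"
  have u: "x < u" "u < y"
    using M0_strict_mean(2) xy by (auto simp: strict_mean_on_def u_def)
  have sub: "{x..y} \<subseteq> I"
    using mem_is_interval_1_I[OF I(1) xI yI] by auto
  have tri: "(v, w) \<in> open_triangle I" if "v \<in> {x..y}" "w \<in> {x..y}" "v < w" for v w
    using that sub by (auto simp: open_triangle_def)
  have Opos: "Omega \<omega>0 \<omega>1 v w > 0" if "v \<in> {x..y}" "w \<in> {x..y}" "v < w" for v w
    using chebyshev tri[OF that] by (auto simp: chebyshev_system_def)
  define l m where "l = (\<lambda>t. \<Lambda> t x y)" and "m = (\<lambda>t. M t x y)"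
  have l: "integrable \<mu> l" and l0: "\<And>t. t \<in> space \<mu> \<Longrightarrow> 0 \<le> l t"
    and m [measurable]: "m \<in> borel_measurable \<mu>"
    using Lambda_integrable Lambda_nonneg M_measurable xy by (auto simp: l_def m_def)
  have [measurable]: "l \<in> borel_measurable \<mu>" using l by auto
  have m_mem: "m t \<in> {x..y}" if "t \<in> space \<mu>" for t
    using M_mean xy that by (auto simp: mean_on_def m_def)

  define S where "S = {(v, w). v \<in> {x..u} \<and> w \<in> {u..y} \<and> v < w}"
  \<comment> \<open>Measurability and bounds are available only on \<open>{x..y}\<close>, and on
    \<open>S\<close> for the error, so everything is cut off there and extended by zero. The
    integrals are unaffected because \<open>m\<close> takes its values in
    \<open>{x..y}\<close>.\<close>
  define w0 w1 g where "w0 v = indicat_real {x..y} v * \<omega>0 v"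
    and "w1 v = indicat_real {x..y} v * \<omega>1 v"
    and "g v = indicat_real {x..y} v * f v" for v
  define e where "e z = indicat_real S z * \<epsilon> (fst z) (snd z) u" for z
  define H where "H z = Omega w0 w1 (fst z) (snd z) * e z" for z
  have in_xy: "w0 v = \<omega>0 v" "w1 v = \<omega>1 v" "g v = f v" if "v \<in> {x..y}" for v
    using that by (auto simp: w0_def w1_def g_def)
  have out_xy: "w0 v = 0" "w1 v = 0" "g v = 0" if "v \<notin> {x..y}" for v
    using that by (auto simp: w0_def w1_def g_def)
  have O_in: "Omega w0 w1 v w = Omega \<omega>0 \<omega>1 v w" if "v \<in> {x..y}" "w \<in> {x..y}" for v w
    using that by (simp add: Omega_def in_xy)
  have O_out: "Omega w0 w1 v w = 0" if "v \<notin> {x..y} \<or> w \<notin> {x..y}" for v w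
    using that by (auto simp: Omega_def out_xy)

  have cont: "continuous_on {x..y} \<omega>0" "continuous_on {x..y} \<omega>1"
    using chebyshev sub by (auto simp: chebyshev_system_def intro: continuous_on_subset)
  have [measurable]: "w0 \<in> borel_measurable borel" "w1 \<in> borel_measurable borel"
    using borel_measurable_continuous_on_indicator[of "{x..y}" \<omega>0]
      borel_measurable_continuous_on_indicator[of "{x..y}" \<omega>1] cont
    by (auto simp: w0_def[abs_def] w1_def[abs_def])
  have "f \<in> borel_measurable (restrict_space borel {x..y})"
    using measurable_restrict_mono[OF f_measurable sub] .
  then have [measurable]: "g \<in> borel_measurable borel"
    by (simp add: borel_measurable_restrict_space_iff g_def[abs_def])
  have S_meas: "S \<in> sets borel"
  proof -
    have "closed ({x..u} \<times> {u..y})" "open {z :: real \<times> real. fst z < snd z}"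
      by (intro closed_Times open_Collect_less continuous_intros closed_atLeastAtMost)+
    moreover have "S = ({x..u} \<times> {u..y}) \<inter> {z. fst z < snd z}" by (auto simp: S_def)
    ultimately show ?thesis by auto
  qed
  have "(\<lambda>(v, w). \<epsilon> v w u) \<in> borel_measurable (restrict_space borel S)"
    using eps_measurable xy u unfolding S_def by fastforce
  then have e_meas: "e \<in> borel_measurable borel"
    using S_meas by (simp add: borel_measurable_restrict_space_iff e_def[abs_def] case_prod_beta)
  have [measurable]: "e \<in> borel_measurable (borel \<Otimes>\<^sub>M borel)"
    using e_meas by (simp add: borel_prod)
  have H_meas: "H \<in> borel_measurable borel"
    unfolding H_def borel_prod[symmetric] by measurable

  \<comment> \<open>Uniform bounds on the interval\<close>
  obtain C0 where C0: "\<And>v. v \<in> {x..y} \<Longrightarrow> \<bar>\<omega>0 v\<bar> \<le> C0" using compact_abs_bound cont by blast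
  obtain C1 where C1: "\<And>v. v \<in> {x..y} \<Longrightarrow> \<bar>\<omega>1 v\<bar> \<le> C1" using compact_abs_bound cont by blast
  have "bounded ((\<lambda>(v, w). \<epsilon> v w u) ` S)"
    using eps_bounded xy u unfolding S_def by fastforce
  then obtain C2 where C2: "\<And>v w. (v, w) \<in> S \<Longrightarrow> \<bar>\<epsilon> v w u\<bar> \<le> C2"
    unfolding bounded_real by fastforce
  obtain C3 where C3: "\<And>v. v \<in> {x..y} \<Longrightarrow> f v \<le> C3"
    using locally_upper_bounded_on_compact[OF f_locally_upper_bounded compact_Icc sub]
    unfolding bdd_above_def by blast
  have C_nonneg: "0 \<le> C0" "0 \<le> C1" using C0[of u] C1[of u] u by auto
  have w_bound: "\<bar>w0 v\<bar> \<le> C0 + C1" "\<bar>w1 v\<bar> \<le> C0 + C1" for v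
    using C0[of v] C1[of v] C_nonneg by (cases "v \<in> {x..y}"; auto simp: in_xy out_xy)+
  define CO where "CO = 2 * (C0 + C1) * (C0 + C1)"
  have O_bound: "\<bar>Omega w0 w1 v w\<bar> \<le> CO" for v w
    unfolding CO_def by (rule Omega_bounded[OF w_bound])
  have CO0: "0 \<le> CO" using O_bound[of u u] by simp
  have e_bound: "\<bar>e z\<bar> \<le> \<bar>C2\<bar>" for z
    using C2[of "fst z" "snd z"] by (auto simp: e_def indicator_def)
  \<comment> \<open>The hypothesis on \<open>f\<close> is applied on each subinterval from
    \<open>v\<close> to \<open>w\<close> containing \<open>u\<close>, and the positive denominator
    is cleared.\<close>
  have ineq: "Omega \<omega>0 \<omega>1 v w * f u \<le>
      Omega \<omega>0 \<omega>1 u w * f v + Omega \<omega>0 \<omega>1 v u * f w + Omega \<omega>0 \<omega>1 v w * \<epsilon> v w u"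
    if "v \<in> {x..u}" "w \<in> {u..y}" "v < w" for v w
  proof -
    have vw: "v \<in> {x..y}" "w \<in> {x..y}" using that u by auto
    have "f u \<le> Omega \<omega>0 \<omega>1 u w / Omega \<omega>0 \<omega>1 v w * f v +
        Omega \<omega>0 \<omega>1 v u / Omega \<omega>0 \<omega>1 v w * f w + \<epsilon> v w u"
      using f_ineq tri[OF vw \<open>v < w\<close>] that by auto
    then show ?thesis
      using Opos[OF vw \<open>v < w\<close>] by (simp add: field_simps)
  qed
  define C where "C = CO + \<bar>C2\<bar> + \<bar>C3\<bar>"
  have C_ge: "CO \<le> C" "\<bar>C2\<bar> \<le> C" "\<bar>C3\<bar> \<le> C" using CO0 by (auto simp: C_def)
  obtain B where B: "\<And>v. v \<in> {x..y} \<Longrightarrow> \<bar>f v\<bar> \<le> B"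
  proof (rule upper_bounded_imp_bounded[of x y \<omega>0 \<omega>1 C u f "\<lambda>v w. \<epsilon> v w u"])
    fix v assume v: "v \<in> {x..y}"
    show "\<bar>Omega \<omega>0 \<omega>1 v y\<bar> \<le> C" "\<bar>Omega \<omega>0 \<omega>1 x v\<bar> \<le> C" "\<bar>Omega \<omega>0 \<omega>1 v u\<bar> \<le> C"
      using O_bound[of v y] O_bound[of x v] O_bound[of v u] O_in[of v y] O_in[of x v] O_in[of v u]
        v u \<open>x < y\<close> C_ge by auto
    show "f v \<le> C" using C3[OF v] C_ge by linarith
  next
    fix v w assume "v \<in> {x..u}" "w \<in> {u..y}" "v < w"
    then show "\<bar>\<epsilon> v w u\<bar> \<le> C" using C2[of v w] C_ge by (force simp: S_def)
  qed (use u Opos ineq in auto)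
  have B0: "0 \<le> B" using B[of u] u by auto
  have g_bound: "\<bar>g v\<bar> \<le> B" for v
    using B[of v] B0 by (cases "v \<in> {x..y}") (auto simp: in_xy out_xy)
  have H_bound: "\<bar>H z\<bar> \<le> CO * \<bar>C2\<bar>" for z
    unfolding H_def abs_mult using O_bound e_bound CO0 by (intro mult_mono) auto
  \<comment> \<open>One constant bounding the four functions of the Jensen lemma and also, through
    \<open>CO\<close>, the kernel of the denominator.\<close>
  define C' where "C' = (C0 + C1) + B + CO + CO * \<bar>C2\<bar>"
  have C'_ge: "C0 + C1 \<le> C'" "B \<le> C'" "CO \<le> C'" "CO * \<bar>C2\<bar> \<le> C'"
    using C_nonneg B0 CO0 by (auto simp: C'_def)

  \<comment> \<open>Passage to the image measure\<close>
  define N where "N = distr (density \<mu> l) borel m"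
  interpret N: finite_measure N
    unfolding N_def
    by (intro finite_measure.finite_measure_distr finite_measure_density_integrable l l0) auto
  have N_int: "(LINT v|N. h v) = (LINT t|\<mu>. l t * h (m t))"
    if "h \<in> borel_measurable borel" for h
    unfolding N_def using that l0 by (intro integral_distr_density) auto
  have N_int': "(LINT v|N. h v) = (LINT t|\<mu>. l t * h' (m t))"
    if "h \<in> borel_measurable borel" "\<And>v. v \<in> {x..y} \<Longrightarrow> h v = h' v" for h h'
    unfolding N_int[OF that(1)] using that(2) m_mem
    by (intro Bochner_Integration.integral_cong) auto
  have u_mem: "u \<in> {x..y}" using u by auto
  have w0_int: "(LINT v|N. w0 v) = w0 u" "(LINT v|N. w1 v) = w1 u"
    using N_int'[of w0 \<omega>0] N_int'[of w1 \<omega>1] omega0_eq omega1_eq xy u_mem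
    by (auto simp: in_xy l_def m_def u_def)
  \<comment> \<open>Pulled back to \<open>\<mu>\<close>, the assumption says that the determinant at
    \<open>m t\<close> and \<open>u\<close> vanishes for almost all \<open>t\<close> with
    \<open>l t > 0\<close>. By the Chebyshev property this forces \<open>m t = u\<close>,
    contradicting \<open>M_neq_M0\<close>.\<close>
  have nondeg: "\<not> (AE v in N. Omega w0 w1 v u = 0)"
  proof
    assume "AE v in N. Omega w0 w1 v u = 0"
    then have "AE t in \<mu>. 0 < l t \<longrightarrow> Omega w0 w1 (m t) u = 0"
      unfolding N_def by (subst (asm) AE_distr_iff) (auto simp: AE_density)
    then have "AE t in \<mu>. \<not> (0 < l t \<and> m t \<noteq> u)"
      using AE_space
    proof eventually_elim
      case (elim t)
      show ?case
        using Opos[of "m t" u] Opos[of u "m t"] Omega_swap[of \<omega>0 \<omega>1 u "m t"] elim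
          O_in[OF m_mem[of t] u_mem] m_mem[of t] u_mem
        by (cases "m t" u rule: linorder_cases) auto
    qed
    then have "emeasure \<mu> {t \<in> space \<mu>. 0 < l t \<and> m t \<noteq> u} = 0"
      by (subst (asm) AE_iff_measurable[OF _ refl]) auto
    moreover have "emeasure \<mu> {t \<in> space \<mu>. 0 < l t \<and> m t \<noteq> u} > 0"
      using M_neq_M0 xy by (auto simp: l_def m_def u_def)
    ultimately show False by simp
  qed
  define D where "D = (LINT v|N. LINT w|N. indicator ({..<u} \<times> {u..}) (v, w) * Omega w0 w1 v w)"
  define Num where "Num = (LINT v|N. LINT w|N. indicator ({..<u} \<times> {u..}) (v, w) * H (v, w))"
  have core: "D > 0" "g u \<le> (LINT v|N. g v) + Num / D"
  proof -
    have 1: "finite_measure N" "sets N = sets borel"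
      by unfold_locales (simp add: N_def)
    have 2: "\<bar>w0 v\<bar> \<le> C'" "\<bar>w1 v\<bar> \<le> C'" "\<bar>g v\<bar> \<le> C'" "\<bar>H z\<bar> \<le> C'" for v z
      using w_bound[of v] g_bound[of v] H_bound[of z] C'_ge by linarith+
    have 3: "w0 u > 0" using omega0_pos u_mem sub by (auto simp: in_xy)
    \<comment> \<open>Outside \<open>{x..y}\<close> the cut-off determinant is zero, so only the
      weak sign condition holds globally.\<close>
    have 4: "0 \<le> Omega w0 w1 v u" if "v < u" for v
      using Opos[of v u] O_in[of v u] O_out[of v u] u_mem that by (cases "v \<in> {x..y}") auto
    have 5: "0 \<le> Omega w0 w1 u w" if "u \<le> w" for w
      using Opos[of u w] O_in[of u w] O_out[of u w] u_mem that
      by (cases "w \<in> {x..y}"; cases "u = w") auto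
    have 6: "Omega w0 w1 v w * g u \<le> Omega w0 w1 u w * g v + Omega w0 w1 v u * g w + H (v, w)"
      if vw: "v < u" "u \<le> w" for v w
    proof (cases "v \<in> {x..y} \<and> w \<in> {x..y}")
      case True
      then show ?thesis
        using ineq[of v w] vw u_mem by (auto simp: O_in in_xy H_def e_def S_def)
    next
      \<comment> \<open>If \<open>v\<close> is outside, \<open>g v\<close> and
        \<open>Omega w0 w1 v u\<close> vanish; if \<open>w\<close> is, \<open>g w\<close> and
        \<open>Omega w0 w1 u w\<close> do. The remaining terms contain
        \<open>Omega w0 w1 v w = 0\<close>, so both sides are zero once each product has lost a
        factor.\<close>
      case False
      then show ?thesis
        using out_xy(3)[of v] out_xy(3)[of w] O_out[of v w] O_out[of v u] O_out[of u w]
        by (auto simp: H_def)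
    qed
    show "D > 0" "g u \<le> (LINT v|N. g v) + Num / D"
      unfolding D_def Num_def
      using Jensen_finite_measure[OF 1 _ _ _ H_meas 2 w0_int 3 4 5 nondeg 6] by simp_all
  qed

  \<comment> \<open>The iterated integrals in the error term\<close>
  have T: "T_lower \<mu> \<Lambda> M M0 x y = {t \<in> space \<mu>. l t > 0 \<and> m t < u}"
    "T_upper \<mu> \<Lambda> M M0 x y = {t \<in> space \<mu>. l t > 0 \<and> m t \<ge> u}"
    by (simp_all add: T_lower_def T_upper_def l_def m_def u_def)
  have R_meas: "{..<u} \<times> {u..} \<in> sets borel"
    unfolding borel_prod[symmetric] by measurable
  \<comment> \<open>Used twice: with the determinant as \<open>F\<close> for the denominator, and
    with \<open>H\<close> for the numerator.\<close>
  have iter: "iterated_integrable \<mu> (T_lower \<mu> \<Lambda> M M0 x y) (T_upper \<mu> \<Lambda> M M0 x y) K"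
    "iterated_integral \<mu> (T_lower \<mu> \<Lambda> M M0 x y) (T_upper \<mu> \<Lambda> M M0 x y) K =
      (LINT v|N. LINT w|N. indicator ({..<u} \<times> {u..}) (v, w) * F (v, w))"
    if F: "F \<in> borel_measurable borel" "\<And>z. \<bar>F z\<bar> \<le> C'"
      and KF: "\<And>t s. t \<in> space \<mu> \<Longrightarrow> s \<in> space \<mu> \<Longrightarrow> m t < u \<Longrightarrow> u \<le> m s \<Longrightarrow>
        K t s = l t * (l s * F (m t, m s))" for F K
  proof -
    let ?G = "\<lambda>z. indicator ({..<u} \<times> {u..}) z * F z"
    have "?G \<in> borel_measurable borel" using F R_meas by measurable
    moreover have "\<bar>?G z\<bar> \<le> C'" for z
      using F(2)[of z] by (auto simp: indicator_def)
    moreover have "K t s = l t * (l s * ?G (m t, m s))"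
      if "t \<in> space \<mu>" "s \<in> space \<mu>" "m t < u" "u \<le> m s" for t s
      using KF[OF that] that by simp
    moreover have "?G (v, w) = 0" if "\<not> (v < u \<and> u \<le> w)" for v w
      using that by (auto simp: indicator_def)
    ultimately have *: "?G \<in> borel_measurable borel" "\<And>z. \<bar>?G z\<bar> \<le> C'"
      "\<And>t s. t \<in> space \<mu> \<Longrightarrow> s \<in> space \<mu> \<Longrightarrow> m t < u \<Longrightarrow> u \<le> m s \<Longrightarrow>
        K t s = l t * (l s * ?G (m t, m s))"
      "\<And>v w. \<not> (v < u \<and> u \<le> w) \<Longrightarrow> ?G (v, w) = 0"
      by blast+
    show "iterated_integrable \<mu> (T_lower \<mu> \<Lambda> M M0 x y) (T_upper \<mu> \<Lambda> M M0 x y) K"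
      unfolding T by (rule iterated_integral_distr_density(1)[OF l l0 m *])
    show "iterated_integral \<mu> (T_lower \<mu> \<Lambda> M M0 x y) (T_upper \<mu> \<Lambda> M M0 x y) K =
      (LINT v|N. LINT w|N. ?G (v, w))"
      unfolding T N_def by (rule iterated_integral_distr_density(2)[OF l l0 m *])
  qed
  have O_meas: "(\<lambda>z. Omega w0 w1 (fst z) (snd z)) \<in> borel_measurable borel"
    unfolding borel_prod[symmetric] by measurable
  have O_bound': "\<bar>Omega w0 w1 (fst z) (snd z)\<bar> \<le> C'" for z
    using O_bound C'_ge order_trans by blast
  have H_bound': "\<bar>H z\<bar> \<le> C'" for z
    using H_bound C'_ge order_trans by blast
  have den: "E_weight \<Lambda> M \<omega>0 \<omega>1 x y t s = l t * (l s * Omega w0 w1 (fst (m t, m s)) (snd (m t, m s)))"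
    if "t \<in> space \<mu>" "s \<in> space \<mu>" for t s
    using m_mem[OF that(1)] m_mem[OF that(2)] by (simp add: E_weight_def O_in l_def m_def)
  \<comment> \<open>The position of \<open>m t\<close> and \<open>m s\<close> relative to
    \<open>u\<close> places the pair in \<open>S\<close>, where the cut-off \<open>e\<close> agrees
    with the error term.\<close>
  have num: "E_weight \<Lambda> M \<omega>0 \<omega>1 x y t s * \<epsilon> (M t x y) (M s x y) (M0 x y) =
      l t * (l s * H (m t, m s))"
    if "t \<in> space \<mu>" "s \<in> space \<mu>" "m t < u" "u \<le> m s" for t s
  proof -
    have "(m t, m s) \<in> S"
      using m_mem[OF that(1)] m_mem[OF that(2)] that(3,4) by (auto simp: S_def)
    then have "e (m t, m s) = \<epsilon> (M t x y) (M s x y) (M0 x y)"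
      by (simp add: e_def m_def u_def)
    then show ?thesis by (simp add: den[OF that(1,2)] H_def)
  qed
  note iter_den = iter[OF O_meas O_bound' den, simplified] and iter_num = iter[OF H_meas H_bound' num]
  show "E_well_defined \<mu> \<Lambda> M M0 \<omega>0 \<omega>1 \<epsilon> x y"
    using iter_den iter_num core(1) by (simp add: E_well_defined_def D_def)
  \<comment> \<open>A bounded function on a finite measure space; hence the integral of
    \<open>f\<close> along the mean is a genuine one and not a default value.\<close>
  have "integrable N g"
    using g_bound by (intro N.integrable_const_bound[where B = B]) (auto simp: N_def)
  then have "integrable \<mu> (\<lambda>t. l t * g (m t))"
    using integrable_distr_density[of l \<mu> m g] l0 by (auto simp: N_def)
  moreover have "integrable \<mu> (\<lambda>t. l t * g (m t)) \<longleftrightarrow> integrable \<mu> (\<lambda>t. \<Lambda> t x y * f (M t x y))"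
    using m_mem by (intro Bochner_Integration.integrable_cong) (auto simp: in_xy l_def m_def)
  ultimately show "integrable \<mu> (\<lambda>t. \<Lambda> t x y * f (M t x y))" by simp
  have "E_term \<mu> \<Lambda> M M0 \<omega>0 \<omega>1 \<epsilon> x y = Num / D"
    using iter_den iter_num by (simp add: E_term_def Num_def D_def)
  moreover have "(LINT v|N. g v) = (LINT t|\<mu>. \<Lambda> t x y * f (M t x y))"
    using N_int'[of g f] by (simp add: in_xy l_def m_def)
  moreover have "g u = f (M0 x y)" using in_xy(3)[OF u_mem] by (simp add: u_def)
  ultimately show "f (M0 x y) \<le> (LINT t|\<mu>. \<Lambda> t x y * f (M t x y)) + E_term \<mu> \<Lambda> M M0 \<omega>0 \<omega>1 \<epsilon> x y"
    using core(2) by simp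
qed

end
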